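(* Let $q\in(0,1)$. Let $\{A_n\}_{n\ge 1}$ be a sequence of real numbers with $A_1=1$, and put $B_n=\dfrac{A_n(1-q^n)}{1-q}$ for all $n\ge 1$. Suppose that either $$1\ge B_3\ge B_5\ge\cdots\ge B_{2n-1}\ge\cdots\ge 0$$ or $$1\le B_3\le B_5\le\cdots\le B_{2n-1}\le\cdots\le 2 .$$ Then $f(z)=z+\sum_{n=2}^\infty A_{2n-1}z^{2n-1}$ belongs to $\mathcal{K}_q$ with the function $g(z)=z/(1-z^2)$.
   Context: $\mathbb{D}=\{z\in\mathbb{C}:|z|<1\}$. $\mathcal{A}$ is the class of functions $f$ analytic in $\mathbb{D}$ with $f(0)=0=f'(0)-1$. $\mathcal{S}^*\subset\mathcal{A}$ is the class of univalent functions $g\in\mathcal{A}$ that are starlike with respect to the origin ($tw\in g(\mathbb{D})$ whenever $t\in[0,1]$, $w\in g(\mathbb{D})$). For $q\in(0,1)$ and $f\in\mathcal{A}$, the $q$-difference operator is $(D_qf)(z)=\dfrac{f(z)-f(qz)}{z(1-q)}$ for $z\in\mathbb{D}\setminus\{0\}$, and $(D_qf)(0)=f'(0)$. A function $f\in\mathcal{A}$ belongs to $\mathcal{K}_q$ ($q$-close-to-convex functions) if there exists $g\in\mathcal{S}^*$ such that $$\left|\frac{z}{g(z)}(D_qf)(z)-\frac{1}{1-q}\right|\le\frac{1}{1-q},\quad z\in\mathbb{D}$$ (where $z/g(z)$ is given its limit value $1$ at $z=0$); one then says that $f\in\mathcal{K}_q$ with the function $g$. *)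

theory Defs
  imports "HOL-Complex_Analysis.Complex_Analysis"
begin

text \<open>
  Functions on the open unit disk are modelled as total functions on the complex numbers; every
  notion below depends only on their values on \<^term>\<open>ball 0 1 :: complex set\<close>.
\<close>

definition normalized_analytic :: "(complex \<Rightarrow> complex) set" where
  "normalized_analytic = {f. f analytic_on ball 0 1 \<and> f 0 = 0 \<and> deriv f 0 = 1}"

text \<open>The library predicate \<^const>\<open>starlike\<close> allows an arbitrary centre, so starlikeness
  with respect to the origin is spelled out.\<close>

definition starlike_univalent :: "(complex \<Rightarrow> complex) set" where
  "starlike_univalent = {g \<in> normalized_analytic.
     inj_on g (ball 0 1) \<and>
     (\<forall>t\<in>{0..1::real}. \<forall>w\<in>g ` ball 0 1. of_real t * w \<in> g ` ball 0 1)}"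

definition q_diff :: "real \<Rightarrow> (complex \<Rightarrow> complex) \<Rightarrow> complex \<Rightarrow> complex" where
  "q_diff q f z =
     (if z = 0 then deriv f 0 else (f z - f (of_real q * z)) / (z * (1 - of_real q)))"

text \<open>For \<^term>\<open>g \<in> starlike_univalent\<close> the only zero of \<^term>\<open>g\<close> in the disk is the origin,
  where \<^term>\<open>z / g z\<close> is given its limit value 1.\<close>

definition q_close_to_convex_with ::
    "real \<Rightarrow> (complex \<Rightarrow> complex) \<Rightarrow> (complex \<Rightarrow> complex) \<Rightarrow> bool" where
  "q_close_to_convex_with q f g \<longleftrightarrow>
     f \<in> normalized_analytic \<and> g \<in> starlike_univalent \<and>
     (\<forall>z\<in>ball 0 1.
        cmod ((if z = 0 then 1 else z / g z) * q_diff q f z - of_real (1 / (1 - q))) \<le> 1 / (1 - q))"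

definition q_close_to_convex :: "real \<Rightarrow> (complex \<Rightarrow> complex) set" where
  "q_close_to_convex q = {f. \<exists>g. q_close_to_convex_with q f g}"

end

theory Submission
  imports Defs
begin

text \<open>
  Write \<open>b k = B (2 * k + 1)\<close>, so that \<open>b 0 = 1\<close>. The factor \<open>(1 - q ^ n) / (1 - q)\<close> relating
  \<open>A n\<close> to \<open>B n\<close> is exactly what the \<open>q\<close>-difference operator does to the monomial \<open>z ^ n\<close>, so
  \<open>D\<^sub>q f\<close> is the power series \<open>\<Sum>k. b k * z ^ (2 * k)\<close>. For the function \<open>g z = z / (1 - z\<^sup>2)\<close> one has
  \<open>z / g z = 1 - z\<^sup>2\<close>, and multiplication by \<open>1 - z\<^sup>2\<close> turns the coefficients into differences:
  \<open>(z / g z) * D\<^sub>q f z = 1 + (\<Sum>k. (b (k + 1) - b k) * z ^ (2 * k + 2))\<close>.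

  Because \<open>b\<close> is monotone, the moduli of these differences telescope, and because \<open>b\<close> stays within
  distance 1 of \<open>b 0 = 1\<close> they add up to at most 1 (lemma \<open>norm_one_minus_mult_suminf_le\<close>). Hence
  \<open>(z / g z) * D\<^sub>q f z\<close> lies within distance 1 of the point 1, and the closed unit disk about 1 is
  contained in the closed disk about \<open>1 / (1 - q)\<close> of radius \<open>1 / (1 - q)\<close>: the two circles are
  internally tangent at 0.

  It remains to see that \<open>g\<close> is univalent and starlike. Univalence is an algebraic identity, and
  starlikeness is read off from the image of the disk, which is the plane cut along the two rays of
  the imaginary axis going from \<open>\<plusminus>\<i> / 2\<close> to infinity (lemma \<open>image_two_slit_map\<close>).
\<close>

section \<open>The two-slit map\<close>

lemma one_minus_square_nonzero:
  fixes z :: complex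
  assumes "norm z < 1"
  shows "1 - z ^ 2 \<noteq> 0"
proof
  assume "1 - z ^ 2 = 0"
  hence "z = 1 \<or> z = - 1" by (simp add: power2_eq_1_iff)
  thus False using assms by auto
qed

text \<open>
  The equation \<open>g z = g w\<close> clears to \<open>(z - w) * (1 + z * w) = 0\<close>, and the second factor cannot vanish
  inside the disk.
\<close>

lemma inj_on_two_slit_map: "inj_on (\<lambda>z :: complex. z / (1 - z ^ 2)) (ball 0 1)"
proof (rule inj_onI)
  fix z w :: complex
  assume z: "z \<in> ball 0 1" and w: "w \<in> ball 0 1"
    and eq: "z / (1 - z ^ 2) = w / (1 - w ^ 2)"
  have "z * (1 - w ^ 2) = w * (1 - z ^ 2)"
    using eq one_minus_square_nonzero[of z] one_minus_square_nonzero[of w] z w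
    by (simp add: frac_eq_eq)
  hence prod: "(z - w) * (1 + z * w) = 0"
    by (simp add: algebra_simps power2_eq_square)
  have "norm z * norm w < 1 * 1"
    using z w by (intro mult_strict_mono') auto
  hence "norm (z * w) \<noteq> 1" by (simp add: norm_mult)
  moreover have "norm (z * w) = 1" if "1 + z * w = 0"
    using that by (metis add_eq_0_iff norm_minus_cancel norm_one)
  ultimately show "z = w" using prod by auto
qed

text \<open>
  The real part of \<open>g z\<close> is a positive multiple of \<open>Re z\<close>, so \<open>g\<close> takes purely imaginary values only
  on the imaginary axis, where \<open>g (\<i> * y) = \<i> * (y / (1 + y\<^sup>2))\<close>.
\<close>

lemma abs_Im_two_slit_map:
  assumes "norm z < 1" "Re (z / (1 - z ^ 2)) = 0"
  shows "\<bar>Im (z / (1 - z ^ 2))\<bar> < 1 / 2"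
proof -
  define N where "N = (norm (1 - z ^ 2))\<^sup>2"
  have N: "N > 0"
    unfolding N_def using one_minus_square_nonzero[OF assms(1)] by simp
  have "(norm z)\<^sup>2 < 1" using assms(1) by (simp add: power_less_one_iff)
  hence r: "(Re z)\<^sup>2 + (Im z)\<^sup>2 < 1" by (simp add: cmod_power2)
  have "Re (z / (1 - z ^ 2)) = Re z * (1 - ((Re z)\<^sup>2 + (Im z)\<^sup>2)) / N"
    unfolding N_def Re_divide' by (simp add: power2_eq_square algebra_simps)
  hence x: "Re z = 0" using assms(2) r N by auto
  define y where "y = Im z"
  have z: "z = \<i> * of_real y" using x by (simp add: complex_eq_iff y_def)
  have "1 - z ^ 2 = of_real (1 + y\<^sup>2)" unfolding z by (simp add: power_mult_distrib)
  hence "z / (1 - z ^ 2) = \<i> * of_real (y / (1 + y\<^sup>2))" unfolding z by simp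
  hence Im: "Im (z / (1 - z ^ 2)) = y / (1 + y\<^sup>2)" by simp
  have "\<bar>y\<bar> < 1" using assms(1) z by (simp add: norm_mult)
  hence "0 < (1 - \<bar>y\<bar>)\<^sup>2" by simp
  hence "2 * \<bar>y\<bar> < 1 + y\<^sup>2" by (simp add: power2_eq_square algebra_simps)
  moreover have "0 < 1 + y\<^sup>2" by (simp add: add_pos_nonneg)
  ultimately show ?thesis unfolding Im by (simp add: abs_divide field_simps)
qed

text \<open>
  Solving \<open>g z = w\<close> means solving a quadratic equation whose two roots have product \<open>-1\<close>, so one of
  them lies in the closed disk. If it lies on the unit circle, then \<open>1 / w = 1 / z - z = cnj z - z\<close>
  is purely imaginary of modulus at most 2, which puts \<open>w\<close> on one of the slits.
\<close>

lemma two_slit_map_surj: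
  assumes w: "Re w \<noteq> 0 \<or> \<bar>Im w\<bar> < 1 / 2"
  shows "\<exists>z. norm z < 1 \<and> z / (1 - z ^ 2) = w"
proof (cases "w = 0")
  case True
  thus ?thesis by (intro exI[of _ 0]) auto
next
  case False
  define c where "c = 1 / w"
  define s where "s = csqrt (c ^ 2 + 4)"
  have s: "s ^ 2 = c ^ 2 + 4" by (simp add: s_def)
  define z1 z2 where "z1 = (s - c) / 2" and "z2 = (- s - c) / 2"
  have prod: "z1 * z2 = - 1"
    using s by (simp add: z1_def z2_def power2_eq_square algebra_simps)
  have root1: "z1 ^ 2 + c * z1 - 1 = 0"
    using s by (simp add: z1_def power2_eq_square field_simps)
  have root2: "z2 ^ 2 + c * z2 - 1 = 0"
    using s by (simp add: z2_def power2_eq_square field_simps)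
  have "norm z1 * norm z2 = 1" using prod by (metis norm_mult norm_minus_cancel norm_one)
  hence "norm z1 \<le> 1 \<or> norm z2 \<le> 1"
    by (metis linorder_not_le less_1_mult less_irrefl)
  then obtain z where z: "norm z \<le> 1" and root: "z ^ 2 + c * z - 1 = 0"
    using root1 root2 by blast
  have "norm z \<noteq> 1"
  proof
    assume n: "norm z = 1"
    have zc: "z * cnj z = 1" using n by (simp add: complex_norm_square [symmetric])
    have "c = (z * cnj z) * c" using zc by simp
    also have "\<dots> = cnj z * (c * z)" by (simp add: ac_simps)
    also have "c * z = 1 - z ^ 2" using root by (simp add: algebra_simps)
    also have "cnj z * (1 - z ^ 2) = cnj z - (z * cnj z) * z"
      by (simp add: power2_eq_square algebra_simps)
    also have "\<dots> = cnj z - z" using zc by simp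
    finally have c: "c = cnj z - z" .
    define y where "y = - 2 * Im z"
    have cy: "c = \<i> * of_real y" unfolding c by (simp add: complex_eq_iff y_def)
    have ny: "y \<noteq> 0" using cy False by (auto simp: c_def)
    have "w = 1 / c" by (simp add: c_def)
    also have "\<dots> = - (\<i> * of_real (1 / y))" using ny by (simp add: cy field_simps)
    finally have w_eq: "w = - (\<i> * of_real (1 / y))" .
    have "Re w = 0" "\<bar>Im w\<bar> = 1 / \<bar>y\<bar>" unfolding w_eq by (auto simp: abs_divide)
    moreover have "\<bar>y\<bar> \<le> 2" using abs_Im_le_cmod[of z] n by (simp add: y_def abs_mult)
    hence "1 / \<bar>y\<bar> \<ge> 1 / 2" using ny by (intro divide_left_mono) auto
    ultimately show False using w by auto
  qed
  with z have lt: "norm z < 1" by simp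
  have "1 - z ^ 2 = c * z" using root by (simp add: algebra_simps)
  hence "w * (1 - z ^ 2) = w * (c * z)" by simp
  also have "\<dots> = z" using False by (simp add: c_def)
  finally have "z / (1 - z ^ 2) = w"
    using one_minus_square_nonzero[OF lt] by (simp add: field_simps)
  with lt show ?thesis by blast
qed

lemma image_two_slit_map:
  "(\<lambda>z :: complex. z / (1 - z ^ 2)) ` ball 0 1 = {w. Re w \<noteq> 0 \<or> \<bar>Im w\<bar> < 1 / 2}"
proof (intro set_eqI iffI)
  fix w :: complex
  assume "w \<in> (\<lambda>z. z / (1 - z ^ 2)) ` ball 0 1"
  thus "w \<in> {w. Re w \<noteq> 0 \<or> \<bar>Im w\<bar> < 1 / 2}" using abs_Im_two_slit_map by auto
next
  fix w :: complex
  assume "w \<in> {w. Re w \<noteq> 0 \<or> \<bar>Im w\<bar> < 1 / 2}"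
  then obtain z where "norm z < 1" "z / (1 - z ^ 2) = w" using two_slit_map_surj by auto
  thus "w \<in> (\<lambda>z. z / (1 - z ^ 2)) ` ball 0 1" by (intro image_eqI[of _ _ z]) auto
qed

lemma starlike_univalent_two_slit_map: "(\<lambda>z. z / (1 - z ^ 2)) \<in> starlike_univalent"
proof -
  have "(\<lambda>z :: complex. z / (1 - z ^ 2)) holomorphic_on ball 0 1"
    using one_minus_square_nonzero by (intro holomorphic_intros) auto
  hence "(\<lambda>z :: complex. z / (1 - z ^ 2)) analytic_on ball 0 1"
    by (simp add: analytic_on_open)
  moreover have "((\<lambda>z :: complex. z / (1 - z ^ 2)) has_field_derivative 1) (at 0)"
    by (auto intro!: derivative_eq_intros)
  hence "deriv (\<lambda>z :: complex. z / (1 - z ^ 2)) 0 = 1" by (rule DERIV_imp_deriv)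
  moreover have "(0 :: complex) / (1 - 0 ^ 2) = 0" by simp
  moreover have "of_real t * w \<in> (\<lambda>z. z / (1 - z ^ 2)) ` ball 0 1"
    if "t \<in> {0..1}" "w \<in> (\<lambda>z. z / (1 - z ^ 2)) ` ball 0 1" for t :: real and w :: complex
  proof -
    have "\<bar>t * Im w\<bar> \<le> \<bar>Im w\<bar>"
      using that(1) by (simp add: abs_mult mult_left_le_one_le)
    thus ?thesis using that(2) unfolding image_two_slit_map by auto
  qed
  ultimately show ?thesis
    unfolding starlike_univalent_def normalized_analytic_def using inj_on_two_slit_map by blast
qed

section \<open>Power series with bounded or monotone coefficients\<close>

lemma summable_bounded_coeffs:
  fixes a :: "nat \<Rightarrow> 'a :: {real_normed_div_algebra, banach}"
  assumes a: "\<And>k. norm (a k) \<le> M" and u: "norm u < 1"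
  shows "summable (\<lambda>k. a k * u ^ k)"
proof (rule summable_comparison_test)
  show "\<exists>N. \<forall>n\<ge>N. norm (a n * u ^ n) \<le> M * norm u ^ n"
    using a by (auto simp: norm_mult norm_power intro!: mult_right_mono)
  show "summable (\<lambda>n. M * norm u ^ n)" using u by (intro summable_mult summable_geometric) simp
qed

text \<open>
  Monotonicity makes all the differences have the same sign, so that the sum of absolute values is
  the absolute value of a telescoping sum.
\<close>

lemma sum_abs_diff_monoseq:
  fixes b :: "nat \<Rightarrow> real"
  assumes "monoseq b"
  shows "(\<Sum>k<n. \<bar>b (Suc k) - b k\<bar>) = \<bar>b n - b 0\<bar>"
  using assms unfolding monoseq_iff
proof
  assume b: "incseq b"
  have "(\<Sum>k<n. \<bar>b (Suc k) - b k\<bar>) = (\<Sum>k<n. b (Suc k) - b k)"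
    using incseq_SucD[OF b] by (intro sum.cong) auto
  thus ?thesis using incseqD[OF b, of 0 n] by (simp add: sum_lessThan_telescope)
next
  assume b: "decseq b"
  have "(\<Sum>k<n. \<bar>b (Suc k) - b k\<bar>) = (\<Sum>k<n. b k - b (Suc k))"
    using decseq_SucD[OF b] by (intro sum.cong) (simp_all add: abs_of_nonpos)
  thus ?thesis using decseqD[OF b, of 0 n] by (simp add: sum_lessThan_telescope')
qed

text \<open>
  Multiplying by \<open>1 - u\<close> replaces the coefficients by their successive differences; for a monotone
  sequence the total variation is controlled by the distance from the initial value.
\<close>

lemma norm_one_minus_mult_suminf_le:
  fixes b :: "nat \<Rightarrow> real" and u :: complex
  assumes mono: "monoseq b" and L: "\<And>k. \<bar>b k - b 0\<bar> \<le> L" and u: "norm u < 1"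
  shows "norm ((1 - u) * (\<Sum>k. of_real (b k) * u ^ k) - of_real (b 0)) \<le> L"
proof -
  have "norm (of_real (b k) :: complex) \<le> L + \<bar>b 0\<bar>" for k
    using L[of k] by simp
  hence sm: "summable (\<lambda>k. of_real (b k) * u ^ k)"
    using u by (rule summable_bounded_coeffs)
  define S where "S = (\<Sum>k. of_real (b k) * u ^ k)"
  have sums: "(\<lambda>k. of_real (b k) * u ^ k) sums S"
    unfolding S_def using sm by (rule summable_sums)
  have "(\<lambda>k. of_real (b (Suc k)) * u ^ Suc k) sums (S - of_real (b 0))"
    using sums by (subst sums_Suc_iff) simp
  from sums_diff[OF this sums_mult[OF sums, of u]]
  have d: "(\<lambda>k. of_real (b (Suc k) - b k) * u ^ Suc k) sums ((1 - u) * S - of_real (b 0))"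
    by (simp add: algebra_simps)
  have bound: "norm (\<Sum>k<n. of_real (b (Suc k) - b k) * u ^ Suc k) \<le> L" for n
  proof -
    have "norm (\<Sum>k<n. of_real (b (Suc k) - b k) * u ^ Suc k) \<le> (\<Sum>k<n. \<bar>b (Suc k) - b k\<bar>)"
    proof (rule sum_norm_le)
      fix k
      have "norm (u ^ Suc k) \<le> 1"
        unfolding norm_power using u by (intro power_le_one) auto
      hence "\<bar>b (Suc k) - b k\<bar> * norm (u ^ Suc k) \<le> \<bar>b (Suc k) - b k\<bar>"
        by (rule mult_left_le) simp
      thus "norm (of_real (b (Suc k) - b k) * u ^ Suc k) \<le> \<bar>b (Suc k) - b k\<bar>"
        by (simp only: norm_mult norm_of_real)
    qed
    also have "\<dots> = \<bar>b n - b 0\<bar>" by (rule sum_abs_diff_monoseq[OF mono])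
    also have "\<dots> \<le> L" by (rule L)
    finally show ?thesis .
  qed
  show ?thesis
    using tendsto_norm[OF d[unfolded sums_def]] bound
    unfolding S_def by (intro LIMSEQ_le_const2) auto
qed

section \<open>Odd power series\<close>

text \<open>
  An odd series is \<open>z * h (z\<^sup>2)\<close> for an ordinary power series \<open>h\<close>, from which analyticity and the
  value \<open>h 0\<close> of the derivative at the origin follow.
\<close>

lemma odd_series_normalized_analytic:
  fixes a :: "nat \<Rightarrow> real"
  assumes a: "\<And>k. \<bar>a k\<bar> \<le> M" and a0: "a 0 = 1"
    and f: "\<And>z. norm z < 1 \<Longrightarrow> (\<lambda>k. of_real (a k) * z ^ (2 * k + 1)) sums f z"
  shows "f \<in> normalized_analytic"
proof -
  define h :: "complex \<Rightarrow> complex" where "h u = (\<Sum>k. of_real (a k) * u ^ k)" for u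
  have sm: "(\<lambda>k. of_real (a k) * u ^ k) sums h u" if "norm u < 1" for u :: complex
    unfolding h_def using a that by (intro summable_sums summable_bounded_coeffs[of _ M]) auto
  have h: "h holomorphic_on ball 0 1"
    using sm by (intro power_series_holomorphic[where a = "\<lambda>k. of_real (a k)"]) auto
  have sq: "norm (z ^ 2) < 1" if "norm z < 1" for z :: complex
    using that by (simp add: norm_power power_less_one_iff)
  have fh: "f z = z * h (z ^ 2)" if "norm z < 1" for z
  proof -
    have "(\<lambda>k. z * (of_real (a k) * (z ^ 2) ^ k)) sums (z * h (z ^ 2))"
      by (rule sums_mult[OF sm[OF sq[OF that]]])
    hence "(\<lambda>k. of_real (a k) * z ^ (2 * k + 1)) sums (z * h (z ^ 2))"
      by (simp add: power_mult [symmetric] mult_ac)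
    thus ?thesis using f[OF that] sums_unique2 by blast
  qed
  have comp: "(\<lambda>z. h (z ^ 2)) holomorphic_on ball 0 1"
  proof -
    have "h \<circ> (\<lambda>z. z ^ 2) holomorphic_on ball 0 1"
      using sq by (intro holomorphic_on_compose_gen[OF _ h] holomorphic_intros) auto
    thus ?thesis by (simp add: o_def)
  qed
  hence "(\<lambda>z. z * h (z ^ 2)) holomorphic_on ball 0 1" by (intro holomorphic_intros)
  hence "f holomorphic_on ball 0 1"
    by (rule holomorphic_transform) (simp add: fh)
  hence "f analytic_on ball 0 1" by (simp add: analytic_on_open)
  moreover have "f 0 = 0" using fh[of 0] by simp
  moreover have "deriv f 0 = 1"
  proof -
    have "(\<lambda>z. h (z ^ 2)) field_differentiable at 0"
      using comp by (auto simp: holomorphic_on_open field_differentiable_def)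
    then obtain D where "((\<lambda>z. h (z ^ 2)) has_field_derivative D) (at 0)"
      by (auto simp: field_differentiable_def)
    from DERIV_mult[OF DERIV_ident this]
    have "((\<lambda>z. z * h (z ^ 2)) has_field_derivative h 0) (at 0)" by simp
    moreover have "h 0 = 1" unfolding h_def using a0 by simp
    moreover have "eventually (\<lambda>z. z * h (z ^ 2) = f z) (nhds 0)"
      by (rule eventually_nhds_in_open[THEN eventually_mono, of "ball 0 1"]) (auto simp: fh)
    ultimately have "(f has_field_derivative 1) (at 0)"
      by (subst (asm) DERIV_cong_ev) auto
    thus ?thesis by (rule DERIV_imp_deriv)
  qed
  ultimately show ?thesis unfolding normalized_analytic_def by simp
qed

lemma q_diff_odd_series:
  fixes a :: "nat \<Rightarrow> real"
  assumes q: "0 < q" "q < 1" and z: "norm z < 1" "z \<noteq> 0"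
    and f: "\<And>z. norm z < 1 \<Longrightarrow> (\<lambda>k. of_real (a k) * z ^ (2 * k + 1)) sums f z"
  shows "(\<lambda>k. of_real (a k * (1 - q ^ (2 * k + 1)) / (1 - q)) * (z ^ 2) ^ k) sums q_diff q f z"
proof -
  define d where "d = z * (1 - of_real q)"
  have q1: "(1 :: complex) - of_real q \<noteq> 0"
    using q by (metis eq_iff_diff_eq_0 of_real_eq_1_iff less_irrefl)
  have "norm (of_real q * z) < 1"
    using q z mult_strict_mono'[of q 1 "norm z" 1] by (simp add: norm_mult)
  from sums_divide[OF sums_diff[OF f[OF z(1)] f[OF this]], of d]
  have "(\<lambda>k. (of_real (a k) * z ^ (2 * k + 1) - of_real (a k) * (of_real q * z) ^ (2 * k + 1)) / d)
          sums q_diff q f z"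
    using z by (simp add: q_diff_def d_def)
  moreover have "(of_real (a k) * z ^ (2 * k + 1) - of_real (a k) * (of_real q * z) ^ (2 * k + 1)) / d
      = of_real (a k * (1 - q ^ (2 * k + 1)) / (1 - q)) * (z ^ 2) ^ k" for k
    using z q1 by (simp add: d_def power_mult_distrib power_mult [symmetric] field_simps)
  ultimately show ?thesis by simp
qed

section \<open>The coefficient criterion\<close>

text \<open>
  This is the coefficient criterion with the odd-indexed coefficients renumbered from 0. Both chains
  of inequalities are instances of one hypothesis: a monotone sequence with values in \<open>[0, 2]\<close>, that
  is, at distance at most 1 from the initial value 1.
\<close>

lemma odd_series_q_close_to_convex:
  fixes a b :: "nat \<Rightarrow> real"
  assumes q: "0 < q" "q < 1"
    and b: "\<And>k. b k = a k * (1 - q ^ (2 * k + 1)) / (1 - q)"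
    and b0: "b 0 = 1" and mono: "monoseq b" and L: "\<And>k. \<bar>b k - 1\<bar> \<le> 1"
    and a: "\<And>k. \<bar>a k\<bar> \<le> M"
    and f: "\<And>z. norm z < 1 \<Longrightarrow> (\<lambda>k. of_real (a k) * z ^ (2 * k + 1)) sums f z"
  shows "q_close_to_convex_with q f (\<lambda>z. z / (1 - z ^ 2))"
proof -
  have a0: "a 0 = 1" using b[of 0] b0 q by simp
  have fn: "f \<in> normalized_analytic"
    using a a0 f by (rule odd_series_normalized_analytic)
  have near: "cmod (P - of_real (1 / (1 - q))) \<le> 1 / (1 - q)" if "cmod (P - 1) \<le> 1" for P
  proof -
    have "P - of_real (1 / (1 - q)) = (P - 1) + of_real (1 - 1 / (1 - q))" by simp
    also have "cmod \<dots> \<le> cmod (P - 1) + cmod (of_real (1 - 1 / (1 - q)))"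
      by (rule norm_triangle_ineq)
    also have "\<dots> \<le> 1 + \<bar>1 - 1 / (1 - q)\<bar>"
      unfolding norm_of_real using that by (rule add_right_mono)
    also have "\<dots> = 1 / (1 - q)" using q by (simp add: abs_if field_simps)
    finally show ?thesis .
  qed
  have "cmod ((if z = 0 then 1 else z / (z / (1 - z ^ 2))) * q_diff q f z - 1) \<le> 1"
    if z: "norm z < 1" for z
  proof (cases "z = 0")
    case True
    thus ?thesis using fn by (simp add: q_diff_def normalized_analytic_def)
  next
    case False
    have "q_diff q f z = (\<Sum>k. of_real (b k) * (z ^ 2) ^ k)"
      using q_diff_odd_series[OF q z False f] unfolding b by (simp add: sums_iff)
    moreover have "norm (z ^ 2) < 1" using z by (simp add: norm_power power_less_one_iff)
    ultimately have "cmod ((1 - z ^ 2) * q_diff q f z - 1) \<le> 1"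
      using norm_one_minus_mult_suminf_le[OF mono, of 1 "z ^ 2"] L b0 by simp
    thus ?thesis using False by simp
  qed
  thus ?thesis
    unfolding q_close_to_convex_with_def
    using fn starlike_univalent_two_slit_map near by simp
qed

theorem theorem2p6:
  fixes q :: real and A B :: "nat \<Rightarrow> real" and f :: "complex \<Rightarrow> complex"
  assumes q: "0 < q" "q < 1"
    and A1: "A 1 = 1"
    and B: "\<And>n. n \<ge> 1 \<Longrightarrow> B n = A n * (1 - q ^ n) / (1 - q)"
    and chain:
      "(1 \<ge> B 3 \<and> (\<forall>n\<ge>2. B (2 * n - 1) \<ge> B (2 * n + 1)) \<and> (\<forall>n\<ge>2. B (2 * n - 1) \<ge> 0)) \<or>
       (1 \<le> B 3 \<and> (\<forall>n\<ge>2. B (2 * n - 1) \<le> B (2 * n + 1)) \<and> (\<forall>n\<ge>2. B (2 * n - 1) \<le> 2))"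
    and f: "\<And>z. z \<in> ball 0 1 \<Longrightarrow>
      f z = z + (\<Sum>n. of_real (A (2 * (n + 2) - 1)) * z ^ (2 * (n + 2) - 1))"
  shows "(\<forall>z\<in>ball 0 1. summable (\<lambda>n. of_real (A (2 * (n + 2) - 1)) * z ^ (2 * (n + 2) - 1) :: complex)) \<and>
    f \<in> q_close_to_convex q \<and>
    q_close_to_convex_with q f (\<lambda>z. z / (1 - z ^ 2))"
proof -
  define a where "a k = A (2 * k + 1)" for k
  define b where "b k = B (2 * k + 1)" for k
  have b: "b k = a k * (1 - q ^ (2 * k + 1)) / (1 - q)" for k
    unfolding a_def b_def by (rule B) simp
  have b0: "b 0 = 1" using b[of 0] A1 q by (simp add: a_def)
  have B3: "B 3 = b (Suc 0)" by (simp add: b_def)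
  have odd: "B (2 * (j + 2) - 1) = b (Suc j)" "B (2 * (j + 2) + 1) = b (Suc (Suc j))" for j
    by (simp_all add: b_def)
  have steps: "(\<forall>k. b (Suc k) \<le> b k) \<and> (\<forall>k. 0 \<le> b k) \<or> (\<forall>k. b k \<le> b (Suc k)) \<and> (\<forall>k. b k \<le> 2)"
    using chain
  proof (elim disjE conjE)
    assume 3: "B 3 \<le> 1" and dec: "\<forall>n\<ge>2. B (2 * n + 1) \<le> B (2 * n - 1)"
      and nonneg: "\<forall>n\<ge>2. 0 \<le> B (2 * n - 1)"
    have "b (Suc k) \<le> b k" "0 \<le> b k" for k
    proof -
      have "b (Suc (Suc j)) \<le> b (Suc j)" "0 \<le> b (Suc j)" for j
        using dec[rule_format, of "j + 2"] nonneg[rule_format, of "j + 2"] unfolding odd by simp_all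
      thus "b (Suc k) \<le> b k" "0 \<le> b k" using 3 B3 b0 by (cases k; simp)+
    qed
    thus ?thesis by blast
  next
    assume 3: "1 \<le> B 3" and inc: "\<forall>n\<ge>2. B (2 * n - 1) \<le> B (2 * n + 1)"
      and le2: "\<forall>n\<ge>2. B (2 * n - 1) \<le> 2"
    have "b k \<le> b (Suc k)" "b k \<le> 2" for k
    proof -
      have "b (Suc j) \<le> b (Suc (Suc j))" "b (Suc j) \<le> 2" for j
        using inc[rule_format, of "j + 2"] le2[rule_format, of "j + 2"] unfolding odd by simp_all
      thus "b k \<le> b (Suc k)" "b k \<le> 2" using 3 B3 b0 by (cases k; simp)+
    qed
    thus ?thesis by blast
  qed
  have mono: "monoseq b" using steps unfolding monoseq_Suc by blast
  have L: "\<bar>b k - 1\<bar> \<le> 1" for k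
  proof -
    have "b k \<le> b 0" if "\<forall>k. b (Suc k) \<le> b k"
      using that by (intro decseqD[of b 0 k] decseq_SucI) auto
    moreover have "b 0 \<le> b k" if "\<forall>k. b k \<le> b (Suc k)"
      using that by (intro incseqD[of b 0 k] incseq_SucI) auto
    ultimately show ?thesis using steps b0 by (smt (verit))
  qed
  \<comment> \<open>The factor \<open>(1 - q ^ n) / (1 - q)\<close> is at least 1, so the coefficients of \<open>f\<close> inherit the bound 2
    that holds for \<open>b\<close>.\<close>
  have a: "\<bar>a k\<bar> \<le> 2" for k
  proof -
    have "q ^ (2 * k + 1) \<le> q ^ 1" using q by (intro power_decreasing) auto
    hence "1 \<le> (1 - q ^ (2 * k + 1)) / (1 - q)" using q by simp
    hence "1 \<le> \<bar>(1 - q ^ (2 * k + 1)) / (1 - q)\<bar>" by (rule order_trans[OF _ abs_ge_self])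
    hence "\<bar>a k\<bar> * 1 \<le> \<bar>a k\<bar> * \<bar>(1 - q ^ (2 * k + 1)) / (1 - q)\<bar>"
      by (rule mult_left_mono) simp
    also have "\<dots> = \<bar>b k\<bar>" by (simp add: b abs_mult)
    finally show ?thesis using L[of k] by linarith
  qed
  have sm: "summable (\<lambda>k. of_real (a k) * z ^ (2 * k + 1) :: complex)" if "norm z < 1" for z :: complex
  proof -
    have "norm (z ^ 2) < 1" using that by (simp add: norm_power power_less_one_iff)
    hence "summable (\<lambda>k. of_real (a k) * (z ^ 2) ^ k)"
      using a by (intro summable_bounded_coeffs[of _ 2]) auto
    from summable_mult[OF this, of z] show ?thesis
      by (simp add: power_mult [symmetric] mult_ac)
  qed
  have idx: "2 * (n + 2) - 1 = 2 * Suc n + 1" for n :: nat by simp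
  have tail: "summable (\<lambda>n. of_real (A (2 * (n + 2) - 1)) * z ^ (2 * (n + 2) - 1) :: complex)"
    if "norm z < 1" for z :: complex
    using sm[OF that] unfolding idx a_def[symmetric]
    by (subst summable_Suc_iff[where f = "\<lambda>k. of_real (a k) * z ^ (2 * k + 1)"])
  have fs: "(\<lambda>k. of_real (a k) * z ^ (2 * k + 1)) sums f z" if z: "norm z < 1" for z
  proof -
    have "(\<lambda>k. of_real (a (Suc k)) * z ^ (2 * Suc k + 1)) sums (f z - z)"
      using summable_sums[OF tail[OF z]] f[of z] z unfolding idx a_def[symmetric] by simp
    thus ?thesis
      using sums_Suc_iff[of "\<lambda>k. of_real (a k) * z ^ (2 * k + 1)" "f z - z"] A1
      by (simp add: a_def)
  qed
  have "q_close_to_convex_with q f (\<lambda>z. z / (1 - z ^ 2))"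
    using q b b0 mono L a fs by (rule odd_series_q_close_to_convex)
  thus ?thesis using tail unfolding q_close_to_convex_def by auto
qed

end
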